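(* Let $\langle \mathfrak K,\mathfrak L\rangle$ be a pair of categories with property $(\mathfrak H)$. Assume $\mathfrak K$ has a Fraïssé sequence $U$ and let $X$ be an arbitrary sequence in $\mathfrak K$. The following properties are equivalent. (a) $X$ is $\mathfrak K$-injective in $\sigma(\mathfrak K,\mathfrak L)$. (b) There exist a $\sigma\mathfrak K$-arrow $J\colon X\to U$ and a $\sigma(\mathfrak K,\mathfrak L)$-arrow $R\colon U\to X$ such that $R\circ J=\operatorname{id}_X$. (c) $X$ is a retract of $U$ in $\sigma(\mathfrak K,\mathfrak L)$, i.e. there exist $\sigma(\mathfrak K,\mathfrak L)$-arrows $J\colon X\to U$ and $R\colon U\to X$ such that $R\circ J=\operatorname{id}_X$.
   Context: Sequences. A sequence in a category $\mathfrak K$ is a covariant functor $X\colon\omega\to\mathfrak K$; write $x_n=X(n)$ and $x_n^m\colon x_n\to x_m$ ($n\le m$) for its objects and arrows. An arrow of sequences $X\to Y$ is an equivalence class of natural transformations $\tau=\{\tau(n)\colon x_n\to y_{\psi(n)}\}_{n\in\omega}$ from $X$ to $Y\circ\psi$, where $\psi\colon\omega\to\omega$ is a non-decreasing function. Two such transformations $\tau_0$ (with $\psi_0$) and $\tau_1$ (with $\psi_1$) are equivalent if for every $n$ there is $m\ge\max\{\psi_0(n),\psi_1(n)\}$ with $y_{\psi_0(n)}^m\circ\tau_0(n)=y_{\psi_1(n)}^m\circ\tau_1(n)$. This gives the category $\sigma\mathfrak K$ of sequences in $\mathfrak K$. For categories $\mathfrak K\subseteq\mathfrak L$ with the same objects,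 $\sigma(\mathfrak K,\mathfrak L)$ is the category whose objects are the sequences in $\mathfrak K$ and whose arrows $X\to Y$ are all $\sigma\mathfrak L$-arrows $X\to Y$. An object $x$ of $\mathfrak K$ is identified with the constant sequence $x\to x\to\cdots$ of identities, so $\mathfrak K\subseteq\sigma\mathfrak K$. Fraïssé sequence. A sequence $U$ in $\mathfrak K$ is a Fraïssé sequence in $\mathfrak K$ if (F1) for every object $x$ of $\mathfrak K$ there are $n\in\omega$ and a $\mathfrak K$-arrow $x\to u_n$; (F2) for every $n$ and every $\mathfrak K$-arrow $f\colon u_n\to y$ there are $m\ge n$ and a $\mathfrak K$-arrow $g\colon y\to u_m$ with $g\circ f=u_n^m$. Property $(\mathfrak H)$. The pair $\langle\mathfrak K,\mathfrak L\rangle$ has property $(\mathfrak H)$ if the following four conditions hold. (0) $\mathfrak K\subseteq\mathfrak L$ is a subcategory with the same objects. (1) $\mathfrak K$ has the amalgamation property (for all $\mathfrak K$-arrows $f\colon c\to a$, $g\colon c\to b$ there are $\mathfrak K$-arrows $f'\colon a\to w$, $g'\colon b\to w$ with $f'\circ f=g'\circ g$) and the joint embedding property (for all objects $a,b$ there are an object $d$ and $\mathfrak K$-arrows $a\to d$, $b\to d$). (2) Mixed amalgamation property: for all $f\colon c\to a$ in $\mathfrak K$ and $g\colon c\to b$ in $\mathfrak L$ there are $f'\colon a\to w$ in $\mathfrak L$ and $g'\colon b\to w$ in $\mathfrak K$ with $f'\circ f=g'\circ g$. (3) Amalgamated extension property: for all $\mathfrak K$-arrows $i\colon c\to a$, $j\colon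 c\to b$ and $\mathfrak L$-arrows $f\colon a\to x$, $g\colon b\to x$ with $f\circ i=g\circ j$ there are $\mathfrak K$-arrows $e\colon x\to y$, $k\colon a\to w$, $\ell\colon b\to w$ and an $\mathfrak L$-arrow $h\colon w\to y$ with $e\circ f=h\circ k$, $e\circ g=h\circ\ell$ and $k\circ i=\ell\circ j$. Injectivity. A sequence $A$ in $\mathfrak K$ is $\mathfrak K$-injective in $\sigma(\mathfrak K,\mathfrak L)$ if for every $\mathfrak K$-arrow $i\colon a\to b$ and every $\sigma(\mathfrak K,\mathfrak L)$-arrow $f\colon a\to A$ there is a $\sigma(\mathfrak K,\mathfrak L)$-arrow $\bar f\colon b\to A$ with $\bar f\circ i=f$. *)

theory Defs
  imports Main
begin

section \<open>Categories\<close>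

text \<open>A category is given by carrier sets of objects and arrows; values outside the carriers are
  irrelevant. \<open>Comp C g f\<close> is \<open>g\<close> after \<open>f\<close>.\<close>

record ('o, 'a) cat =
  Obj :: "'o set"
  Arr :: "'a set"
  Dom :: "'a \<Rightarrow> 'o"
  Cod :: "'a \<Rightarrow> 'o"
  Ident :: "'o \<Rightarrow> 'a"
  Comp :: "'a \<Rightarrow> 'a \<Rightarrow> 'a"

definition hom :: "('o, 'a) cat \<Rightarrow> 'o \<Rightarrow> 'o \<Rightarrow> 'a set" where
  "hom C x y = {f \<in> Arr C. Dom C f = x \<and> Cod C f = y}"

locale category =
  fixes C :: "('o, 'a) cat"
  assumes Dom_Obj: "f \<in> Arr C \<Longrightarrow> Dom C f \<in> Obj C"
    and Cod_Obj: "f \<in> Arr C \<Longrightarrow> Cod C f \<in> Obj C"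
    and Ident_hom: "x \<in> Obj C \<Longrightarrow> Ident C x \<in> hom C x x"
    and Comp_hom: "\<lbrakk>f \<in> hom C x y; g \<in> hom C y z\<rbrakk> \<Longrightarrow> Comp C g f \<in> hom C x z"
    and Comp_Ident_right: "f \<in> hom C x y \<Longrightarrow> Comp C f (Ident C x) = f"
    and Comp_Ident_left: "f \<in> hom C x y \<Longrightarrow> Comp C (Ident C y) f = f"
    and Comp_assoc: "\<lbrakk>f \<in> hom C w x; g \<in> hom C x y; h \<in> hom C y z\<rbrakk>
      \<Longrightarrow> Comp C h (Comp C g f) = Comp C (Comp C h g) f"

definition subcategory :: "('o, 'a) cat \<Rightarrow> ('o, 'a) cat \<Rightarrow> bool" where
  "subcategory K L \<longleftrightarrow> category K \<and> category L \<and> Obj K \<subseteq> Obj L \<and> Arr K \<subseteq> Arr L \<and>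
     (\<forall>f\<in>Arr K. Dom K f = Dom L f \<and> Cod K f = Cod L f) \<and>
     (\<forall>x\<in>Obj K. Ident K x = Ident L x) \<and>
     (\<forall>f\<in>Arr K. \<forall>g\<in>Arr K. Dom K g = Cod K f \<longrightarrow> Comp K g f = Comp L g f)"

definition full_subcat :: "('o, 'a) cat \<Rightarrow> 'o set \<Rightarrow> ('o, 'a) cat" where
  "full_subcat C S = C\<lparr>Obj := Obj C \<inter> S, Arr := {f \<in> Arr C. Dom C f \<in> S \<and> Cod C f \<in> S}\<rparr>"

definition retract :: "('o, 'a) cat \<Rightarrow> 'o \<Rightarrow> 'o \<Rightarrow> bool" where
  "retract C x u \<longleftrightarrow> (\<exists>j\<in>hom C x u. \<exists>r\<in>hom C u x. Comp C r j = Ident C x)"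


section \<open>Property (H)\<close>

definition amalgamation_property :: "('o, 'a) cat \<Rightarrow> bool" where
  "amalgamation_property K \<longleftrightarrow>
     (\<forall>a b c. \<forall>f\<in>hom K c a. \<forall>g\<in>hom K c b.
        \<exists>w. \<exists>f'\<in>hom K a w. \<exists>g'\<in>hom K b w. Comp K f' f = Comp K g' g)"

definition joint_embedding_property :: "('o, 'a) cat \<Rightarrow> bool" where
  "joint_embedding_property K \<longleftrightarrow>
     (\<forall>a\<in>Obj K. \<forall>b\<in>Obj K. \<exists>d\<in>Obj K. hom K a d \<noteq> {} \<and> hom K b d \<noteq> {})"

definition mixed_amalgamation_property :: "('o, 'a) cat \<Rightarrow> ('o, 'a) cat \<Rightarrow> bool" where
  "mixed_amalgamation_property K L \<longleftrightarrow>
     (\<forall>a b c. \<forall>f\<in>hom K c a. \<forall>g\<in>hom L c b.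
        \<exists>w. \<exists>f'\<in>hom L a w. \<exists>g'\<in>hom K b w. Comp L f' f = Comp L g' g)"

definition amalgamated_extension_property :: "('o, 'a) cat \<Rightarrow> ('o, 'a) cat \<Rightarrow> bool" where
  "amalgamated_extension_property K L \<longleftrightarrow>
     (\<forall>a b c x. \<forall>i\<in>hom K c a. \<forall>j\<in>hom K c b. \<forall>f\<in>hom L a x. \<forall>g\<in>hom L b x.
        Comp L f i = Comp L g j \<longrightarrow>
        (\<exists>y w. \<exists>e\<in>hom K x y. \<exists>k\<in>hom K a w. \<exists>l\<in>hom K b w. \<exists>h\<in>hom L w y.
           Comp L e f = Comp L h k \<and> Comp L e g = Comp L h l \<and> Comp K k i = Comp K l j))"

definition property_H :: "('o, 'a) cat \<Rightarrow> ('o, 'a) cat \<Rightarrow> bool" where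
  "property_H K L \<longleftrightarrow>
     subcategory K L \<and> Obj K = Obj L \<and>
     amalgamation_property K \<and> joint_embedding_property K \<and>
     mixed_amalgamation_property K L \<and> amalgamated_extension_property K L"


section \<open>Sequences\<close>

text \<open>A functor from the poset category \<open>\<omega>\<close>: \<open>sobj X n\<close> is \<open>x\<^sub>n\<close> and \<open>sarr X n m\<close>
  is the arrow from \<open>x\<^sub>n\<close> to \<open>x\<^sub>m\<close>, which is only meaningful for \<open>n \<le> m\<close>.\<close>

record ('o, 'a) seq =
  sobj :: "nat \<Rightarrow> 'o"
  sarr :: "nat \<Rightarrow> nat \<Rightarrow> 'a"

definition sequence :: "('o, 'a) cat \<Rightarrow> ('o, 'a) seq \<Rightarrow> bool" where
  "sequence K X \<longleftrightarrow>
     (\<forall>n. sobj X n \<in> Obj K) \<and>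
     (\<forall>n m. n \<le> m \<longrightarrow> sarr X n m \<in> hom K (sobj X n) (sobj X m)) \<and>
     (\<forall>n. sarr X n n = Ident K (sobj X n)) \<and>
     (\<forall>n m k. n \<le> m \<longrightarrow> m \<le> k \<longrightarrow> Comp K (sarr X m k) (sarr X n m) = sarr X n k)"

definition fraisse_sequence :: "('o, 'a) cat \<Rightarrow> ('o, 'a) seq \<Rightarrow> bool" where
  "fraisse_sequence K U \<longleftrightarrow>
     sequence K U \<and>
     (\<forall>x\<in>Obj K. \<exists>n. hom K x (sobj U n) \<noteq> {}) \<and>
     (\<forall>n y. \<forall>f\<in>hom K (sobj U n) y.
        \<exists>m\<ge>n. \<exists>g\<in>hom K y (sobj U m). Comp K g f = sarr U n m)"


section \<open>The category of sequences\<close>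

text \<open>A transformation is a pair \<open>(\<psi>, \<tau>)\<close> with \<open>\<tau>\<close> natural from \<open>X\<close> to \<open>Y \<circ> \<psi>\<close>.\<close>

type_synonym 'a transf = "(nat \<Rightarrow> nat) \<times> (nat \<Rightarrow> 'a)"

definition transfs ::
  "('o, 'a) cat \<Rightarrow> ('o, 'a) seq \<Rightarrow> ('o, 'a) seq \<Rightarrow> 'a transf set" where
  "transfs K X Y = {(\<psi>, \<tau>). mono \<psi> \<and>
     (\<forall>n. \<tau> n \<in> hom K (sobj X n) (sobj Y (\<psi> n))) \<and>
     (\<forall>n m. n \<le> m \<longrightarrow> Comp K (\<tau> m) (sarr X n m) = Comp K (sarr Y (\<psi> n) (\<psi> m)) (\<tau> n))}"

definition transf_equiv ::
  "('o, 'a) cat \<Rightarrow> ('o, 'a) seq \<Rightarrow> ('o, 'a) seq \<Rightarrow> ('a transf \<times> 'a transf) set" where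
  "transf_equiv K X Y =
     {((\<psi>0, \<tau>0), (\<psi>1, \<tau>1)). (\<psi>0, \<tau>0) \<in> transfs K X Y \<and> (\<psi>1, \<tau>1) \<in> transfs K X Y \<and>
        (\<forall>n. \<exists>m\<ge>max (\<psi>0 n) (\<psi>1 n).
           Comp K (sarr Y (\<psi>0 n) m) (\<tau>0 n) = Comp K (sarr Y (\<psi>1 n) m) (\<tau>1 n))}"

definition transf_comp :: "('o, 'a) cat \<Rightarrow> 'a transf \<Rightarrow> 'a transf \<Rightarrow> 'a transf" where
  "transf_comp K t s = (fst t \<circ> fst s, \<lambda>n. Comp K (snd t (fst s n)) (snd s n))"

type_synonym ('o, 'a) sigma_arr = "('o, 'a) seq \<times> 'a transf set \<times> ('o, 'a) seq"

definition arr_class ::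
  "('o, 'a) cat \<Rightarrow> ('o, 'a) seq \<Rightarrow> ('o, 'a) seq \<Rightarrow> 'a transf \<Rightarrow> ('o, 'a) sigma_arr" where
  "arr_class K X Y t = (X, transf_equiv K X Y `` {t}, Y)"

text \<open>Composition of classes is written as a union over representatives; by \<open>sigma_Comp\<close>
  below this is the class of the composite of any two representatives.\<close>

definition sigma :: "('o, 'a) cat \<Rightarrow> (('o, 'a) seq, ('o, 'a) sigma_arr) cat" where
  "sigma K = \<lparr>
     Obj = {X. sequence K X},
     Arr = {(X, c, Y). sequence K X \<and> sequence K Y \<and> c \<in> transfs K X Y // transf_equiv K X Y},
     Dom = (\<lambda>(X, c, Y). X),
     Cod = (\<lambda>(X, c, Y). Y),
     Ident = (\<lambda>X. arr_class K X X (id, \<lambda>n. Ident K (sobj X n))),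
     Comp = (\<lambda>(Y', d, Z) (X, c, Y).
       (X, \<Union>t\<in>d. \<Union>s\<in>c. transf_equiv K X Z `` {transf_comp K t s}, Z))\<rparr>"

definition sigma_pair ::
  "('o, 'a) cat \<Rightarrow> ('o, 'a) cat \<Rightarrow> (('o, 'a) seq, ('o, 'a) sigma_arr) cat" where
  "sigma_pair K L = full_subcat (sigma L) {X. sequence K X}"

text \<open>The inclusion of \<open>sigma K\<close> into \<open>sigma_pair K L\<close>. It is not literally the identity on
  arrows, because an equivalence class taken in \<open>L\<close> may contain further transformations.\<close>

definition sigma_incl :: "('o, 'a) cat \<Rightarrow> ('o, 'a) sigma_arr \<Rightarrow> ('o, 'a) sigma_arr" where
  "sigma_incl L = (\<lambda>(X, c, Y). (X, transf_equiv L X Y `` c, Y))"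

definition const_seq :: "('o, 'a) cat \<Rightarrow> 'o \<Rightarrow> ('o, 'a) seq" where
  "const_seq K x = \<lparr>sobj = (\<lambda>n. x), sarr = (\<lambda>n m. Ident K x)\<rparr>"

definition const_arr :: "('o, 'a) cat \<Rightarrow> 'a \<Rightarrow> ('o, 'a) sigma_arr" where
  "const_arr K f =
     arr_class K (const_seq K (Dom K f)) (const_seq K (Cod K f)) (id, \<lambda>n. f)"

definition seq_injective ::
  "('o, 'a) cat \<Rightarrow> ('o, 'a) cat \<Rightarrow> ('o, 'a) seq \<Rightarrow> bool" where
  "seq_injective K L A \<longleftrightarrow>
     (\<forall>a b. \<forall>i\<in>hom K a b. \<forall>f\<in>hom (sigma_pair K L) (const_seq K a) A.
        \<exists>f'\<in>hom (sigma_pair K L) (const_seq K b) A.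
          Comp (sigma_pair K L) f' (sigma_incl L (const_arr K i)) = f)"


section \<open>Well-definedness\<close>

lemma homD: "f \<in> hom C x y \<Longrightarrow> f \<in> Arr C \<and> Dom C f = x \<and> Cod C f = y"
  by (simp add: hom_def)

lemma (in category) hom_Obj: "f \<in> hom C x y \<Longrightarrow> x \<in> Obj C \<and> y \<in> Obj C"
  using Dom_Obj Cod_Obj by (auto simp: hom_def)

lemma category_full_subcat:
  assumes "category C"
  shows "category (full_subcat C S)"
proof -
  interpret category C by fact
  have h: "hom (full_subcat C S) x y = (if x \<in> S \<and> y \<in> S then hom C x y else {})" for x y
    by (auto simp: hom_def full_subcat_def)
  have f: "Obj (full_subcat C S) = Obj C \<inter> S"
    "Arr (full_subcat C S) = {f \<in> Arr C. Dom C f \<in> S \<and> Cod C f \<in> S}"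
    "Dom (full_subcat C S) = Dom C" "Cod (full_subcat C S) = Cod C"
    "Ident (full_subcat C S) = Ident C" "Comp (full_subcat C S) = Comp C"
    by (simp_all add: full_subcat_def)
  show ?thesis
    by unfold_locales
      (auto simp: h f Dom_Obj Cod_Obj split: if_splits
        intro: Ident_hom Comp_hom Comp_Ident_left Comp_Ident_right Comp_assoc)
qed

lemma seq_objD: "sequence K X \<Longrightarrow> sobj X n \<in> Obj K"
  and seq_arrD: "sequence K X \<Longrightarrow> n \<le> m \<Longrightarrow> sarr X n m \<in> hom K (sobj X n) (sobj X m)"
  and seq_idD: "sequence K X \<Longrightarrow> sarr X n n = Ident K (sobj X n)"
  and seq_compD: "sequence K X \<Longrightarrow> n \<le> m \<Longrightarrow> m \<le> k \<Longrightarrow>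
    Comp K (sarr X m k) (sarr X n m) = sarr X n k"
  by (auto simp: sequence_def)

lemma transfsD:
  assumes "(\<psi>, \<tau>) \<in> transfs K X Y"
  shows "mono \<psi>" "\<tau> n \<in> hom K (sobj X n) (sobj Y (\<psi> n))"
    "n \<le> m \<Longrightarrow> Comp K (\<tau> m) (sarr X n m) = Comp K (sarr Y (\<psi> n) (\<psi> m)) (\<tau> n)"
  using assms by (auto simp: transfs_def)

context category
begin

lemma push:
  assumes Y: "sequence C Y" and t: "\<tau> \<in> hom C x (sobj Y p)" and "p \<le> m" "m \<le> k"
  shows "Comp C (sarr Y p k) \<tau> = Comp C (sarr Y m k) (Comp C (sarr Y p m) \<tau>)"
  using Comp_assoc[OF t seq_arrD[OF Y \<open>p \<le> m\<close>] seq_arrD[OF Y \<open>m \<le> k\<close>]]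
    seq_compD[OF Y \<open>p \<le> m\<close> \<open>m \<le> k\<close>] by simp

lemma equiv_transf:
  assumes Y: "sequence C Y"
  shows "equiv (transfs C X Y) (transf_equiv C X Y)"
proof (rule equivI)
  show "transf_equiv C X Y \<subseteq> transfs C X Y \<times> transfs C X Y"
    by (auto simp: transf_equiv_def)
  show "refl_on (transfs C X Y) (transf_equiv C X Y)"
    by (auto simp: refl_on_def transf_equiv_def)
  show "sym (transf_equiv C X Y)"
  proof (rule symI)
    fix s t
    assume "(s, t) \<in> transf_equiv C X Y"
    then show "(t, s) \<in> transf_equiv C X Y"
      by (cases s; cases t) (simp add: transf_equiv_def, metis)
  qed
  show "trans (transf_equiv C X Y)"
  proof (rule transI)
    fix s t u
    assume st: "(s, t) \<in> transf_equiv C X Y" and tu: "(t, u) \<in> transf_equiv C X Y"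
    obtain p a q b r c where e: "s = (p, a)" "t = (q, b)" "u = (r, c)"
      by (metis surj_pair)
    have T: "(p, a) \<in> transfs C X Y" "(q, b) \<in> transfs C X Y" "(r, c) \<in> transfs C X Y"
      using st tu by (auto simp: e transf_equiv_def)
    have "\<exists>m\<ge>max (p n) (r n). Comp C (sarr Y (p n) m) (a n) = Comp C (sarr Y (r n) m) (c n)" for n
    proof -
      obtain m1 where m1: "m1 \<ge> p n" "m1 \<ge> q n"
        "Comp C (sarr Y (p n) m1) (a n) = Comp C (sarr Y (q n) m1) (b n)"
        using st by (auto simp: e transf_equiv_def)
      obtain m2 where m2: "m2 \<ge> q n" "m2 \<ge> r n"
        "Comp C (sarr Y (q n) m2) (b n) = Comp C (sarr Y (r n) m2) (c n)"
        using tu by (auto simp: e transf_equiv_def)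
      let ?k = "max m1 m2"
      have "Comp C (sarr Y (p n) ?k) (a n) = Comp C (sarr Y (q n) ?k) (b n)"
        using push[OF Y transfsD(2)[OF T(1)] m1(1), of ?k]
          push[OF Y transfsD(2)[OF T(2)] m1(2), of ?k] m1(3) by simp
      also have "\<dots> = Comp C (sarr Y (r n) ?k) (c n)"
        using push[OF Y transfsD(2)[OF T(2)] m2(1), of ?k]
          push[OF Y transfsD(2)[OF T(3)] m2(2), of ?k] m2(3) by simp
      finally show ?thesis
        using m1 m2 by (intro exI[of _ ?k]) auto
    qed
    then show "(s, u) \<in> transf_equiv C X Y"
      using T by (auto simp: e transf_equiv_def)
  qed
qed

lemma transf_comp_in:
  assumes X: "sequence C X" and Y: "sequence C Y" and Z: "sequence C Z"
    and s: "s \<in> transfs C X Y" and t: "t \<in> transfs C Y Z"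
  shows "transf_comp C t s \<in> transfs C X Z"
proof -
  obtain p a q b where e: "s = (p, a)" "t = (q, b)" by (metis surj_pair)
  note S = transfsD[OF s[unfolded e]] and T = transfsD[OF t[unfolded e]]
  have "Comp C (Comp C (b (p m)) (a m)) (sarr X n m)
      = Comp C (sarr Z (q (p n)) (q (p m))) (Comp C (b (p n)) (a n))" if nm: "n \<le> m" for n m
  proof -
    have pnm: "p n \<le> p m" using S(1) nm by (auto dest: monoD)
    have qnm: "q (p n) \<le> q (p m)" using T(1) pnm by (auto dest: monoD)
    have "Comp C (Comp C (b (p m)) (a m)) (sarr X n m)
        = Comp C (b (p m)) (Comp C (sarr Y (p n) (p m)) (a n))"
      using Comp_assoc[OF seq_arrD[OF X nm] S(2) T(2)] S(3)[OF nm] by simp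
    also have "\<dots> = Comp C (Comp C (sarr Z (q (p n)) (q (p m))) (b (p n))) (a n)"
      using Comp_assoc[OF S(2) seq_arrD[OF Y pnm] T(2)] T(3)[OF pnm] by simp
    also have "\<dots> = Comp C (sarr Z (q (p n)) (q (p m))) (Comp C (b (p n)) (a n))"
      using Comp_assoc[OF S(2) T(2) seq_arrD[OF Z qnm]] by simp
    finally show ?thesis .
  qed
  moreover have "mono (q \<circ> p)" using S(1) T(1) by (auto simp: mono_def)
  ultimately show ?thesis
    using Comp_hom[OF S(2) T(2)] by (auto simp: e transf_comp_def transfs_def comp_def)
qed

lemma transf_comp_cong:
  assumes X: "sequence C X" and Y: "sequence C Y" and Z: "sequence C Z"
    and s: "(s, s') \<in> transf_equiv C X Y" and t: "(t, t') \<in> transf_equiv C Y Z"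
  shows "(transf_comp C t s, transf_comp C t' s') \<in> transf_equiv C X Z"
proof -
  obtain p a q b p' a' q' b' where e: "s = (p, a)" "t = (q, b)" "s' = (p', a')" "t' = (q', b')"
    by (metis surj_pair)
  have m: "s \<in> transfs C X Y" "s' \<in> transfs C X Y" "t \<in> transfs C Y Z" "t' \<in> transfs C Y Z"
    using s t by (auto simp: transf_equiv_def)
  have push2: "Comp C (sarr Z (v (u n)) k) (Comp C (d (u n)) (c n))
      = Comp C (Comp C (sarr Z (v i) k) (d i)) (Comp C (sarr Y (u n) i) (c n))"
    if u: "(u, c) \<in> transfs C X Y" and v: "(v, d) \<in> transfs C Y Z" and i: "u n \<le> i" and k: "v i \<le> k"
    for u c v d n i k
  proof -
    note S = transfsD[OF u] and T = transfsD[OF v]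
    have vi: "v (u n) \<le> v i" using T(1) i by (auto dest: monoD)
    have "Comp C (sarr Z (v (u n)) k) (Comp C (d (u n)) (c n))
      = Comp C (sarr Z (v i) k) (Comp C (sarr Z (v (u n)) (v i)) (Comp C (d (u n)) (c n)))"
      by (rule push[OF Z Comp_hom[OF S(2) T(2)] vi k])
    also have "\<dots> = Comp C (sarr Z (v i) k) (Comp C (d i) (Comp C (sarr Y (u n) i) (c n)))"
      using Comp_assoc[OF S(2) T(2) seq_arrD[OF Z vi]] T(3)[OF i]
        Comp_assoc[OF S(2) seq_arrD[OF Y i] T(2)] by simp
    also have "\<dots> = Comp C (Comp C (sarr Z (v i) k) (d i)) (Comp C (sarr Y (u n) i) (c n))"
      by (rule Comp_assoc[OF Comp_hom[OF S(2) seq_arrD[OF Y i]] T(2) seq_arrD[OF Z k]])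
    finally show ?thesis .
  qed
  have "\<exists>k\<ge>max (q (p n)) (q' (p' n)).
      Comp C (sarr Z (q (p n)) k) (Comp C (b (p n)) (a n))
      = Comp C (sarr Z (q' (p' n)) k) (Comp C (b' (p' n)) (a' n))" for n
  proof -
    obtain i where i: "p n \<le> i" "p' n \<le> i"
      "Comp C (sarr Y (p n) i) (a n) = Comp C (sarr Y (p' n) i) (a' n)"
      using s by (auto simp: e transf_equiv_def)
    obtain k where k: "q i \<le> k" "q' i \<le> k"
      "Comp C (sarr Z (q i) k) (b i) = Comp C (sarr Z (q' i) k) (b' i)"
      using t by (auto simp: e transf_equiv_def)
    have "q (p n) \<le> k" "q' (p' n) \<le> k"
      using transfsD(1)[OF m(3)[unfolded e]] transfsD(1)[OF m(4)[unfolded e]] i k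
      by (meson monoD order_trans)+
    then show ?thesis
      using push2[OF m(1)[unfolded e] m(3)[unfolded e] i(1) k(1)]
        push2[OF m(2)[unfolded e] m(4)[unfolded e] i(2) k(2)] i(3) k(3)
      by (intro exI[of _ k]) auto
  qed
  then show ?thesis
    using transf_comp_in[OF X Y Z m(1) m(3)] transf_comp_in[OF X Y Z m(2) m(4)]
    by (auto simp: e transf_equiv_def transf_comp_def)
qed

lemma hom_sigma:
  assumes "sequence C X" "sequence C Y"
  shows "hom (sigma C) X Y = arr_class C X Y ` transfs C X Y"
  using assms by (auto simp: hom_def sigma_def arr_class_def quotient_def)

lemma hom_sigma_seq: "f \<in> hom (sigma C) X Y \<Longrightarrow> sequence C X \<and> sequence C Y"
  by (auto simp: hom_def sigma_def)

lemma arr_class_eq_iff: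
  assumes "sequence C Y" "s \<in> transfs C X Y" "t \<in> transfs C X Y"
  shows "arr_class C X Y s = arr_class C X Y t \<longleftrightarrow> (s, t) \<in> transf_equiv C X Y"
  using eq_equiv_class_iff[OF equiv_transf[OF assms(1)] assms(2,3)] by (simp add: arr_class_def)

lemma sigma_Comp:
  assumes X: "sequence C X" and Y: "sequence C Y" and Z: "sequence C Z"
    and s: "s \<in> transfs C X Y" and t: "t \<in> transfs C Y Z"
  shows "Comp (sigma C) (arr_class C Y Z t) (arr_class C X Y s) = arr_class C X Z (transf_comp C t s)"
proof -
  have "transf_equiv C X Z `` {transf_comp C t' s'} = transf_equiv C X Z `` {transf_comp C t s}"
    if "t' \<in> transf_equiv C Y Z `` {t}" "s' \<in> transf_equiv C X Y `` {s}" for s' t'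
    using transf_comp_cong[OF X Y Z, of s s' t t'] that equiv_class_eq[OF equiv_transf[OF Z]]
    by (metis Image_singleton_iff)
  moreover have "t \<in> transf_equiv C Y Z `` {t}" "s \<in> transf_equiv C X Y `` {s}"
    using equiv_class_self[OF equiv_transf[OF Z] t] equiv_class_self[OF equiv_transf[OF Y] s] by auto
  ultimately have "(\<Union>t'\<in>transf_equiv C Y Z `` {t}. \<Union>s'\<in>transf_equiv C X Y `` {s}.
      transf_equiv C X Z `` {transf_comp C t' s'}) = transf_equiv C X Z `` {transf_comp C t s}"
    by blast
  then show ?thesis
    by (simp add: sigma_def arr_class_def)
qed

lemma ident_transf:
  assumes X: "sequence C X"
  shows "(id, \<lambda>n. Ident C (sobj X n)) \<in> transfs C X X"
  using Ident_hom[OF seq_objD[OF X]] Comp_Ident_left[OF seq_arrD[OF X]]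
    Comp_Ident_right[OF seq_arrD[OF X]]
  by (auto simp: transfs_def mono_def)

lemma category_sigma: "category (sigma C)"
proof
  show "f \<in> Arr (sigma C) \<Longrightarrow> Dom (sigma C) f \<in> Obj (sigma C)" for f
    by (auto simp: sigma_def)
  show "f \<in> Arr (sigma C) \<Longrightarrow> Cod (sigma C) f \<in> Obj (sigma C)" for f
    by (auto simp: sigma_def)
  have I: "Ident (sigma C) X = arr_class C X X (id, \<lambda>n. Ident C (sobj X n))" for X
    by (simp add: sigma_def)
  show "Ident (sigma C) X \<in> hom (sigma C) X X" if "X \<in> Obj (sigma C)" for X
  proof -
    have "sequence C X" using that by (simp add: sigma_def)
    then show ?thesis using ident_transf by (auto simp: I hom_sigma)
  qed
  show "Comp (sigma C) g f \<in> hom (sigma C) X Z"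
    if f: "f \<in> hom (sigma C) X Y" and g: "g \<in> hom (sigma C) Y Z" for f g X Y Z
  proof -
    have seqs: "sequence C X" "sequence C Y" "sequence C Z"
      using hom_sigma_seq[OF f] hom_sigma_seq[OF g] by auto
    then show ?thesis
      using f g transf_comp_in[OF seqs] by (auto simp: hom_sigma sigma_Comp)
  qed
  show "Comp (sigma C) f (Ident (sigma C) X) = f" if f: "f \<in> hom (sigma C) X Y" for f X Y
  proof -
    have seqs: "sequence C X" "sequence C Y" using hom_sigma_seq[OF f] by auto
    then obtain p a where pa: "(p, a) \<in> transfs C X Y" "f = arr_class C X Y (p, a)"
      using f by (auto simp: hom_sigma)
    have "transf_comp C (p, a) (id, \<lambda>n. Ident C (sobj X n)) = (p, a)"
      using Comp_Ident_right[OF transfsD(2)[OF pa(1)]] by (simp add: transf_comp_def)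
    then show ?thesis
      using sigma_Comp[OF seqs(1) seqs(1,2) ident_transf[OF seqs(1)] pa(1)] by (simp add: I pa(2))
  qed
  show "Comp (sigma C) (Ident (sigma C) Y) f = f" if f: "f \<in> hom (sigma C) X Y" for f X Y
  proof -
    have seqs: "sequence C X" "sequence C Y" using hom_sigma_seq[OF f] by auto
    then obtain p a where pa: "(p, a) \<in> transfs C X Y" "f = arr_class C X Y (p, a)"
      using f by (auto simp: hom_sigma)
    have "transf_comp C (id, \<lambda>n. Ident C (sobj Y n)) (p, a) = (p, a)"
      using Comp_Ident_left[OF transfsD(2)[OF pa(1)]] by (simp add: transf_comp_def)
    then show ?thesis
      using sigma_Comp[OF seqs seqs(2) pa(1) ident_transf[OF seqs(2)]] by (simp add: I pa(2))
  qed
  show "Comp (sigma C) h (Comp (sigma C) g f) = Comp (sigma C) (Comp (sigma C) h g) f"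
    if f: "f \<in> hom (sigma C) W X" and g: "g \<in> hom (sigma C) X Y" and h: "h \<in> hom (sigma C) Y Z"
    for f g h W X Y Z
  proof -
    have W: "sequence C W" and X: "sequence C X" and Y: "sequence C Y" and Z: "sequence C Z"
      using hom_sigma_seq[OF f] hom_sigma_seq[OF h] by auto
    obtain s t u where s: "s \<in> transfs C W X" "f = arr_class C W X s"
      and t: "t \<in> transfs C X Y" "g = arr_class C X Y t"
      and u: "u \<in> transfs C Y Z" "h = arr_class C Y Z u"
      using f g h W X Y Z by (auto simp: hom_sigma)
    obtain p a q b r c where e: "s = (p, a)" "t = (q, b)" "u = (r, c)" by (metis surj_pair)
    have "transf_comp C u (transf_comp C t s) = transf_comp C (transf_comp C u t) s"
      using Comp_assoc[OF transfsD(2)[OF s(1)[unfolded e]] transfsD(2)[OF t(1)[unfolded e]]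
          transfsD(2)[OF u(1)[unfolded e]]]
      by (auto simp: e transf_comp_def)
    then show ?thesis
      using s t u W X Y Z by (simp add: sigma_Comp transf_comp_in)
  qed
qed

end

lemma category_sigma_pair: "category L \<Longrightarrow> category (sigma_pair K L)"
  by (simp add: sigma_pair_def category_full_subcat category.category_sigma)

context
  fixes K L :: "('o, 'a) cat"
  assumes sub: "subcategory K L"
begin

interpretation K: category K using sub by (simp add: subcategory_def)
interpretation L: category L using sub by (simp add: subcategory_def)

lemma sub_hom: "f \<in> hom K x y \<Longrightarrow> f \<in> hom L x y"
  using sub by (auto simp: subcategory_def hom_def)

lemma sub_Comp: "f \<in> hom K x y \<Longrightarrow> g \<in> hom K y z \<Longrightarrow> Comp K g f = Comp L g f"
  using sub by (auto simp: subcategory_def hom_def)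

lemma sub_Ident: "x \<in> Obj K \<Longrightarrow> Ident K x = Ident L x"
  using sub by (auto simp: subcategory_def)

lemma sub_sequence:
  assumes X: "sequence K X"
  shows "sequence L X"
  unfolding sequence_def
proof (intro conjI allI impI)
  show "sobj X n \<in> Obj L" for n
    using sub seq_objD[OF X] by (auto simp: subcategory_def)
  show "sarr X n m \<in> hom L (sobj X n) (sobj X m)" if "n \<le> m" for n m
    using sub_hom seq_arrD[OF X that] by blast
  show "sarr X n n = Ident L (sobj X n)" for n
    using seq_idD[OF X] sub_Ident seq_objD[OF X] by metis
  show "Comp L (sarr X m k) (sarr X n m) = sarr X n k" if "n \<le> m" "m \<le> k" for n m k
    using sub_Comp[OF seq_arrD[OF X that(1)] seq_arrD[OF X that(2)]] seq_compD[OF X that] by simp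
qed

lemma sub_transfs:
  assumes X: "sequence K X" and Y: "sequence K Y" and t: "t \<in> transfs K X Y"
  shows "t \<in> transfs L X Y"
proof -
  obtain p a where e: "t = (p, a)" by (metis surj_pair)
  note T = transfsD[OF t[unfolded e]]
  have "Comp L (a m) (sarr X n m) = Comp L (sarr Y (p n) (p m)) (a n)" if nm: "n \<le> m" for n m
    using T(3)[OF nm] sub_Comp[OF seq_arrD[OF X nm] T(2)]
      sub_Comp[OF T(2) seq_arrD[OF Y monoD[OF T(1) nm]]] by simp
  then show ?thesis
    using T(1) sub_hom[OF T(2)] by (auto simp: e transfs_def)
qed

lemma sub_transf_equiv:
  assumes X: "sequence K X" and Y: "sequence K Y"
    and s: "s \<in> transfs K X Y" and t: "t \<in> transfs K X Y"
  shows "(s, t) \<in> transf_equiv K X Y \<longleftrightarrow> (s, t) \<in> transf_equiv L X Y"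
proof -
  obtain p a q b where e: "s = (p, a)" "t = (q, b)" by (metis surj_pair)
  note S = transfsD[OF s[unfolded e]] and T = transfsD[OF t[unfolded e]]
  have "Comp K (sarr Y (p n) m) (a n) = Comp L (sarr Y (p n) m) (a n)"
    "Comp K (sarr Y (q n) m) (b n) = Comp L (sarr Y (q n) m) (b n)" if "m \<ge> max (p n) (q n)" for n m
    using sub_Comp[OF S(2) seq_arrD[OF Y]] sub_Comp[OF T(2) seq_arrD[OF Y]] that by auto
  then have "(\<forall>n. \<exists>m\<ge>max (p n) (q n).
        Comp K (sarr Y (p n) m) (a n) = Comp K (sarr Y (q n) m) (b n)) \<longleftrightarrow>
      (\<forall>n. \<exists>m\<ge>max (p n) (q n).
        Comp L (sarr Y (p n) m) (a n) = Comp L (sarr Y (q n) m) (b n))"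
    by (metis (no_types, lifting))
  then show ?thesis
    using s t sub_transfs[OF X Y s] sub_transfs[OF X Y t]
    by (simp add: e transf_equiv_def)
qed

lemma sigma_incl_arr_class:
  assumes X: "sequence K X" and Y: "sequence K Y" and t: "t \<in> transfs K X Y"
  shows "sigma_incl L (arr_class K X Y t) = arr_class L X Y t"
proof -
  have eqL: "equiv (transfs L X Y) (transf_equiv L X Y)"
    by (rule L.equiv_transf[OF sub_sequence[OF Y]])
  have "(t, s) \<in> transf_equiv L X Y" if "(t, s) \<in> transf_equiv K X Y" for s
    using sub_transf_equiv[OF X Y t, of s] that by (auto simp: transf_equiv_def)
  moreover have "(t, t) \<in> transf_equiv K X Y"
    using K.equiv_transf[OF Y] t by (meson equiv_def refl_onD)
  ultimately have "transf_equiv L X Y `` (transf_equiv K X Y `` {t}) = transf_equiv L X Y `` {t}"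
    using eqL by (meson Image_singleton_iff ImageE ImageI equiv_def subsetI subset_antisym transD)
  then show ?thesis by (simp add: sigma_incl_def arr_class_def)
qed

lemma hom_sigma_pair:
  assumes "sequence K X" "sequence K Y"
  shows "hom (sigma_pair K L) X Y = hom (sigma L) X Y"
  using assms by (auto simp: sigma_pair_def full_subcat_def hom_def)

lemma sigma_incl_hom:
  assumes "f \<in> hom (sigma K) X Y"
  shows "sigma_incl L f \<in> hom (sigma_pair K L) X Y"
proof -
  have seqs: "sequence K X" "sequence K Y" using K.hom_sigma_seq[OF assms] by auto
  then show ?thesis
    using assms sub_transfs[OF seqs] sub_sequence
    by (auto simp: K.hom_sigma L.hom_sigma hom_sigma_pair sigma_incl_arr_class)
qed

lemma sigma_incl_inj:
  assumes f: "f \<in> hom (sigma K) X Y" and g: "g \<in> hom (sigma K) X Y"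
    and fg: "sigma_incl L f = sigma_incl L g"
  shows "f = g"
proof -
  have X: "sequence K X" and Y: "sequence K Y" using K.hom_sigma_seq[OF f] by auto
  obtain s t where s: "s \<in> transfs K X Y" "f = arr_class K X Y s"
    and t: "t \<in> transfs K X Y" "g = arr_class K X Y t"
    using f g by (auto simp: K.hom_sigma[OF X Y])
  then show ?thesis
    using fg sub_transf_equiv[OF X Y s(1) t(1)]
      L.arr_class_eq_iff[OF sub_sequence[OF Y] sub_transfs[OF X Y s(1)] sub_transfs[OF X Y t(1)]]
      K.arr_class_eq_iff[OF Y s(1) t(1)]
    by (simp add: sigma_incl_arr_class[OF X Y])
qed

lemma sigma_incl_Ident:
  assumes X: "sequence K X"
  shows "sigma_incl L (Ident (sigma K) X) = Ident (sigma_pair K L) X"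
  using sigma_incl_arr_class[OF X X K.ident_transf[OF X]] sub_Ident[OF seq_objD[OF X]]
  by (simp add: sigma_pair_def full_subcat_def sigma_def)

lemma sigma_incl_Comp:
  assumes f: "f \<in> hom (sigma K) X Y" and g: "g \<in> hom (sigma K) Y Z"
  shows "sigma_incl L (Comp (sigma K) g f) = Comp (sigma_pair K L) (sigma_incl L g) (sigma_incl L f)"
proof -
  have X: "sequence K X" and Y: "sequence K Y" and Z: "sequence K Z"
    using K.hom_sigma_seq[OF f] K.hom_sigma_seq[OF g] by auto
  obtain s t where s: "s \<in> transfs K X Y" "f = arr_class K X Y s"
    and t: "t \<in> transfs K Y Z" "g = arr_class K Y Z t"
    using f g by (auto simp: K.hom_sigma[OF X Y] K.hom_sigma[OF Y Z])
  obtain p a q b where e: "s = (p, a)" "t = (q, b)" by (metis surj_pair)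
  have c: "transf_comp K t s = transf_comp L t s"
    using sub_Comp[OF transfsD(2)[OF s(1)[unfolded e]] transfsD(2)[OF t(1)[unfolded e]]]
    by (simp add: e transf_comp_def)
  have P: "Comp (sigma_pair K L) = Comp (sigma L)"
    by (simp add: sigma_pair_def full_subcat_def)
  show ?thesis
    using K.sigma_Comp[OF X Y Z s(1) t(1)] K.transf_comp_in[OF X Y Z s(1) t(1)]
      L.sigma_Comp[OF sub_sequence[OF X] sub_sequence[OF Y] sub_sequence[OF Z]
        sub_transfs[OF X Y s(1)] sub_transfs[OF Y Z t(1)]]
    by (simp add: P s t sigma_incl_arr_class X Y Z c)
qed

end

lemma (in category) const_seq_sequence: "x \<in> Obj C \<Longrightarrow> sequence C (const_seq C x)"
  using Ident_hom Comp_Ident_left by (auto simp: sequence_def const_seq_def)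

lemma (in category) const_arr_hom:
  assumes f: "f \<in> hom C x y"
  shows "const_arr C f \<in> hom (sigma C) (const_seq C x) (const_seq C y)"
proof -
  have "(id, \<lambda>n. f) \<in> transfs C (const_seq C x) (const_seq C y)"
    using f Comp_Ident_left[OF f] Comp_Ident_right[OF f]
    by (auto simp: transfs_def const_seq_def mono_def)
  then show ?thesis
    using hom_Obj[OF f] homD[OF f] by (auto simp: hom_sigma const_seq_sequence const_arr_def)
qed

end

theory Submission
  imports Defs
begin

text \<open>
  An arrow from an object \<open>a\<close> to a sequence \<open>A\<close> is given by a single arrow \<open>a \<rightarrow> a\<^sub>n\<close> at some
  stage \<open>n\<close>, so injectivity of \<open>A\<close> says: for \<open>i : a \<rightarrow> b\<close> in \<open>K\<close>, every \<open>L\<close>-arrow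
  \<open>a \<rightarrow> a\<^sub>n\<close> extends along \<open>i\<close> after moving to a later stage (\<open>seq_injective_iff\<close>).

  Injectivity passes to retracts, and \<open>U\<close> is injective: extend \<open>f : a \<rightarrow> u\<^sub>n\<close> along \<open>i\<close> into a
  mixed amalgam and absorb the \<open>K\<close>-arrow out of \<open>u\<^sub>n\<close> by the Fraisse property
  (\<open>fraisse_sequence_injective\<close>). Hence retracts of \<open>U\<close> are injective.

  Conversely, let \<open>X\<close> be injective. The arrows \<open>J\<close> and \<open>R\<close> are built together as ladders
  \<open>j\<^sub>k : x\<^sub>k \<rightarrow> u\<^sub>p\<close> in \<open>K\<close> and \<open>r\<^sub>k : u\<^sub>p \<rightarrow> x\<^sub>q\<close> in \<open>L\<close> (where \<open>p\<close>, \<open>q\<close> depend on \<open>k\<close>)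
  with \<open>r\<^sub>k \<circ> j\<^sub>k = x\<^sub>k\<^sup>q\<close>.
  For the step (\<open>partial_retraction_step\<close>), amalgamated extension applied to the square
  \<open>r\<^sub>k \<circ> j\<^sub>k = x\<^bsub>k+1\<^esub>\<^sup>q \<circ> x\<^sub>k\<^bsup>k+1\<^esup>\<close> gives a \<open>K\<close>-amalgam \<open>w\<close> of \<open>u\<^sub>p\<close> and
  \<open>x\<^bsub>k+1\<^esub>\<close> over \<open>x\<^sub>k\<close>, with an \<open>L\<close>-arrow from \<open>w\<close> to a \<open>K\<close>-extension \<open>y\<close> of \<open>x\<^sub>q\<close>. The Fraisse
  property maps \<open>w\<close> into \<open>U\<close>, which yields \<open>j\<^bsub>k+1\<^esub>\<close>; a mixed amalgamation extends
  \<open>w \<rightarrow> y\<close> over the new stage of \<open>U\<close>, and injectivity of \<open>X\<close> leads back from that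
  amalgam, a \<open>K\<close>-extension of \<open>x\<^sub>q\<close>, to a later stage of \<open>X\<close>, which yields \<open>r\<^bsub>k+1\<^esub>\<close>.
\<close>


section \<open>Arrows from an object to a sequence\<close>

context category
begin

text \<open>The arrow from (the constant sequence of) \<open>a\<close> to \<open>A\<close> given by an arrow \<open>f\<close> from \<open>a\<close> to
  the \<open>n\<close>-th object of \<open>A\<close>.\<close>

definition stage_arr :: "'o \<Rightarrow> ('o, 'a) seq \<Rightarrow> nat \<Rightarrow> 'a \<Rightarrow> ('o, 'a) sigma_arr" where
  "stage_arr a A n f = arr_class C (const_seq C a) A (\<lambda>_. n, \<lambda>_. f)"

lemma stage_transf:
  assumes A: "sequence C A" and f: "f \<in> hom C a (sobj A n)"
  shows "(\<lambda>_. n, \<lambda>_. f) \<in> transfs C (const_seq C a) A"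
  using f Comp_Ident_right[OF f] Comp_Ident_left[OF f] seq_idD[OF A]
  by (auto simp: transfs_def const_seq_def mono_def)

lemma stage_arr_hom:
  assumes A: "sequence C A" and f: "f \<in> hom C a (sobj A n)"
  shows "stage_arr a A n f \<in> hom (sigma C) (const_seq C a) A"
  using stage_transf[OF A f] hom_Obj[OF f] A
  by (auto simp: hom_sigma const_seq_sequence stage_arr_def)

lemma stage_arr_eq_iff:
  assumes A: "sequence C A" and f: "f \<in> hom C a (sobj A n)" and g: "g \<in> hom C a (sobj A m)"
  shows "stage_arr a A n f = stage_arr a A m g \<longleftrightarrow>
    (\<exists>k\<ge>max n m. Comp C (sarr A n k) f = Comp C (sarr A m k) g)"
  using arr_class_eq_iff[OF A stage_transf[OF A f] stage_transf[OF A g]]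
    stage_transf[OF A f] stage_transf[OF A g]
  by (simp add: stage_arr_def transf_equiv_def)

lemma hom_const_seq_stage_arr:
  assumes A: "sequence C A" and a: "a \<in> Obj C"
    and F: "F \<in> hom (sigma C) (const_seq C a) A"
  obtains n f where "f \<in> hom C a (sobj A n)" "F = stage_arr a A n f"
proof -
  obtain p t where t: "(p, t) \<in> transfs C (const_seq C a) A"
    and F_eq: "F = arr_class C (const_seq C a) A (p, t)"
    using F a A by (auto simp: hom_sigma const_seq_sequence)
  note T = transfsD[OF t]
  have th: "t n \<in> hom C a (sobj A (p n))" for n
    using T(2)[of n] by (simp add: const_seq_def)
  have nat: "t n = Comp C (sarr A (p 0) (p n)) (t 0)" for n
    using T(3)[of 0 n] Comp_Ident_right[OF th[of n]] by (simp add: const_seq_def)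
  have le: "p 0 \<le> p n" for n
    by (rule monoD[OF T(1)]) simp
  have "\<exists>m\<ge>max (p n) (p 0). Comp C (sarr A (p n) m) (t n) = Comp C (sarr A (p 0) m) (t 0)" for n
    using nat[of n] Comp_Ident_left[OF th[of n]] seq_idD[OF A] le[of n]
    by (intro exI[of _ "p n"]) simp
  then have "((p, t), (\<lambda>_. p 0, \<lambda>_. t 0)) \<in> transf_equiv C (const_seq C a) A"
    using t stage_transf[OF A th] by (simp add: transf_equiv_def)
  then have "F = stage_arr a A (p 0) (t 0)"
    using arr_class_eq_iff[OF A t stage_transf[OF A th]] by (simp add: F_eq stage_arr_def)
  then show ?thesis using that th by blast
qed

lemma stage_arr_Comp_const_arr:
  assumes A: "sequence C A" and i: "i \<in> hom C a b" and f: "f \<in> hom C b (sobj A n)"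
  shows "Comp (sigma C) (stage_arr b A n f) (const_arr C i) = stage_arr a A n (Comp C f i)"
proof -
  have I: "(id, \<lambda>n. i) \<in> transfs C (const_seq C a) (const_seq C b)"
    using i Comp_Ident_left[OF i] Comp_Ident_right[OF i]
    by (auto simp: transfs_def const_seq_def mono_def)
  have "transf_comp C (\<lambda>_. n, \<lambda>_. f) (id, \<lambda>n. i) = (\<lambda>_. n, \<lambda>_. Comp C f i)"
    by (auto simp: transf_comp_def)
  then show ?thesis
    using sigma_Comp[OF const_seq_sequence const_seq_sequence A I stage_transf[OF A f]]
      hom_Obj[OF i] homD[OF i]
    by (simp add: stage_arr_def const_arr_def)
qed

end


section \<open>Injective sequences\<close>

lemma sigma_pair_Comp: "Comp (sigma_pair K L) = Comp (sigma L)"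
  by (simp add: sigma_pair_def full_subcat_def)

lemma const_seq_sub:
  assumes "subcategory K L" "x \<in> Obj K"
  shows "const_seq K x = const_seq L x"
  using sub_Ident[OF assms] by (simp add: const_seq_def)

lemma sigma_incl_const_arr:
  assumes sub: "subcategory K L" and i: "i \<in> hom K a b"
  shows "sigma_incl L (const_arr K i) = const_arr L i"
proof -
  interpret K: category K using sub by (simp add: subcategory_def)
  have ab: "a \<in> Obj K" "b \<in> Obj K" using K.hom_Obj[OF i] by auto
  have I: "(id, \<lambda>n. i) \<in> transfs K (const_seq K a) (const_seq K b)"
    using i K.Comp_Ident_left[OF i] K.Comp_Ident_right[OF i]
    by (auto simp: transfs_def const_seq_def mono_def)
  show ?thesis
    using sigma_incl_arr_class[OF sub K.const_seq_sequence K.const_seq_sequence I] ab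
      homD[OF i] homD[OF sub_hom[OF sub i]] const_seq_sub[OF sub]
    by (simp add: const_arr_def)
qed

text \<open>Injectivity in terms of arrows into single stages. On the right, an extension is only
  required at some later stage, which reflects equality of arrows of sequences.\<close>

lemma seq_injective_iff:
  assumes sub: "subcategory K L" and A: "sequence K A"
  shows "seq_injective K L A \<longleftrightarrow>
    (\<forall>a b n. \<forall>i\<in>hom K a b. \<forall>f\<in>hom L a (sobj A n).
      \<exists>m\<ge>n. \<exists>f'\<in>hom L b (sobj A m). Comp L f' i = Comp L (sarr A n m) f)"
    (is "_ \<longleftrightarrow> ?stagewise")
proof -
  interpret K: category K using sub by (simp add: subcategory_def)
  interpret L: category L using sub by (simp add: subcategory_def)
  have AL: "sequence L A" by (rule sub_sequence[OF sub A])
  have H: "hom (sigma_pair K L) (const_seq K a) A = hom (sigma L) (const_seq L a) A"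
    if "a \<in> Obj K" for a
    using hom_sigma_pair[OF sub K.const_seq_sequence[OF that] A]
    by (simp add: const_seq_sub[OF sub that])
  show ?thesis
  proof
    assume inj: "seq_injective K L A"
    show ?stagewise
    proof (intro allI ballI)
      fix a b n i f
      assume i: "i \<in> hom K a b" and f: "f \<in> hom L a (sobj A n)"
      have ab: "a \<in> Obj K" "b \<in> Obj K" using K.hom_Obj[OF i] by auto
      note iL = sub_hom[OF sub i]
      have "L.stage_arr a A n f \<in> hom (sigma_pair K L) (const_seq K a) A"
        using L.stage_arr_hom[OF AL f] by (simp only: H[OF ab(1)])
      then obtain F where "F \<in> hom (sigma_pair K L) (const_seq K b) A"
        "Comp (sigma_pair K L) F (sigma_incl L (const_arr K i)) = L.stage_arr a A n f"
        using inj i unfolding seq_injective_def by blast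
      then have F: "F \<in> hom (sigma L) (const_seq L b) A"
        "Comp (sigma L) F (const_arr L i) = L.stage_arr a A n f"
        by (simp_all only: H[OF ab(2)] sigma_pair_Comp sigma_incl_const_arr[OF sub i])
      obtain m g where g: "g \<in> hom L b (sobj A m)" "F = L.stage_arr b A m g"
        using L.hom_const_seq_stage_arr[OF AL _ F(1)] L.hom_Obj[OF iL] by blast
      have "L.stage_arr a A m (Comp L g i) = L.stage_arr a A n f"
        using L.stage_arr_Comp_const_arr[OF AL iL g(1)] F(2) g(2) by simp
      then obtain k where k: "k \<ge> m" "k \<ge> n"
        "Comp L (sarr A m k) (Comp L g i) = Comp L (sarr A n k) f"
        using L.stage_arr_eq_iff[OF AL L.Comp_hom[OF iL g(1)] f] by auto
      note mk = seq_arrD[OF AL k(1)]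
      show "\<exists>m\<ge>n. \<exists>f'\<in>hom L b (sobj A m). Comp L f' i = Comp L (sarr A n m) f"
        using k L.Comp_assoc[OF iL g(1) mk] L.Comp_hom[OF g(1) mk] by metis
    qed
  next
    assume stagewise: ?stagewise
    show "seq_injective K L A"
      unfolding seq_injective_def
    proof (intro allI ballI)
      fix a b i F
      assume i: "i \<in> hom K a b" and F: "F \<in> hom (sigma_pair K L) (const_seq K a) A"
      have ab: "a \<in> Obj K" "b \<in> Obj K" using K.hom_Obj[OF i] by auto
      note iL = sub_hom[OF sub i]
      obtain n f where f: "f \<in> hom L a (sobj A n)" "F = L.stage_arr a A n f"
        using L.hom_const_seq_stage_arr[OF AL] L.hom_Obj[OF iL] F H[OF ab(1)] by metis
      obtain m g where m: "m \<ge> n" and g: "g \<in> hom L b (sobj A m)"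
        and gi: "Comp L g i = Comp L (sarr A n m) f"
        using stagewise i f(1) by blast
      have gih: "Comp L g i \<in> hom L a (sobj A m)" by (rule L.Comp_hom[OF iL g])
      have "Comp L (sarr A m m) (Comp L g i) = Comp L (sarr A n m) f"
        using L.Comp_Ident_left[OF gih] seq_idD[OF AL] gi by simp
      then have "L.stage_arr a A m (Comp L g i) = F"
        using L.stage_arr_eq_iff[OF AL gih f(1)] m f(2) by auto
      then show "\<exists>F'\<in>hom (sigma_pair K L) (const_seq K b) A.
          Comp (sigma_pair K L) F' (sigma_incl L (const_arr K i)) = F"
        using L.stage_arr_hom[OF AL g] L.stage_arr_Comp_const_arr[OF AL iL g]
        by (intro bexI[of _ "L.stage_arr b A m g"])
          (simp_all add: H ab sigma_pair_Comp sigma_incl_const_arr[OF sub i])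
    qed
  qed
qed

lemma seq_injective_retract:
  assumes sub: "subcategory K L" and inj: "seq_injective K L A"
    and ret: "retract (sigma_pair K L) X A"
  shows "seq_injective K L X"
  unfolding seq_injective_def
proof (intro allI ballI)
  fix a b i F
  assume i: "i \<in> hom K a b" and F: "F \<in> hom (sigma_pair K L) (const_seq K a) X"
  interpret K: category K using sub by (simp add: subcategory_def)
  interpret S: category "sigma_pair K L"
    using sub by (simp add: subcategory_def category_sigma_pair)
  let ?i = "sigma_incl L (const_arr K i)"
  have ih: "?i \<in> hom (sigma_pair K L) (const_seq K a) (const_seq K b)"
    by (rule sigma_incl_hom[OF sub K.const_arr_hom[OF i]])
  obtain J R where J: "J \<in> hom (sigma_pair K L) X A" and R: "R \<in> hom (sigma_pair K L) A X"
    and RJ: "Comp (sigma_pair K L) R J = Ident (sigma_pair K L) X"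
    using ret by (auto simp: retract_def)
  obtain G where G: "G \<in> hom (sigma_pair K L) (const_seq K b) A"
    and Gi: "Comp (sigma_pair K L) G ?i = Comp (sigma_pair K L) J F"
    using inj i S.Comp_hom[OF F J] unfolding seq_injective_def by blast
  have "Comp (sigma_pair K L) (Comp (sigma_pair K L) R G) ?i = F"
    using S.Comp_assoc[OF ih G R] S.Comp_assoc[OF F J R] S.Comp_Ident_left[OF F] Gi RJ by simp
  then show "\<exists>F'\<in>hom (sigma_pair K L) (const_seq K b) X. Comp (sigma_pair K L) F' ?i = F"
    using S.Comp_hom[OF G R] by blast
qed

lemma fraisse_sequence_injective:
  assumes sub: "subcategory K L" and mixed: "mixed_amalgamation_property K L"
    and U: "fraisse_sequence K U"
  shows "seq_injective K L U"
proof -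
  interpret L: category L using sub by (simp add: subcategory_def)
  have seq: "sequence K U" using U by (simp add: fraisse_sequence_def)
  show ?thesis
    unfolding seq_injective_iff[OF sub seq]
  proof (intro allI ballI)
    fix a b n i f
    assume i: "i \<in> hom K a b" and f: "f \<in> hom L a (sobj U n)"
    obtain w f' g' where f': "f' \<in> hom L b w" and g': "g' \<in> hom K (sobj U n) w"
      and eq: "Comp L f' i = Comp L g' f"
      using mixed i f unfolding mixed_amalgamation_property_def by blast
    obtain m h where m: "m \<ge> n" and h: "h \<in> hom K w (sobj U m)"
      and hg: "Comp K h g' = sarr U n m"
      using U g' unfolding fraisse_sequence_def by blast
    note hL = sub_hom[OF sub h] and gL = sub_hom[OF sub g'] and iL = sub_hom[OF sub i]
    have "Comp L (Comp L h f') i = Comp L (sarr U n m) f"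
      using L.Comp_assoc[OF iL f' hL] L.Comp_assoc[OF f gL hL] eq hg sub_Comp[OF sub g' h] by simp
    then show "\<exists>m\<ge>n. \<exists>f'\<in>hom L b (sobj U m). Comp L f' i = Comp L (sarr U n m) f"
      using m L.Comp_hom[OF f' hL] by blast
  qed
qed


section \<open>Injective sequences are retracts of the Fraisse sequence\<close>

text \<open>The later stage provided by the Fraisse property, or by injectivity, can be taken strictly later.\<close>

lemma fraisse_sequence_absorb:
  assumes K: "category K" and U: "fraisse_sequence K U" and f: "f \<in> hom K (sobj U n) y"
  obtains m g where "m > n" "g \<in> hom K y (sobj U m)" "Comp K g f = sarr U n m"
proof -
  interpret category K by (rule K)
  have seq: "sequence K U" using U by (simp add: fraisse_sequence_def)
  obtain m g where m: "m \<ge> n" and g: "g \<in> hom K y (sobj U m)" and gf: "Comp K g f = sarr U n m"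
    using U f unfolding fraisse_sequence_def by blast
  have s: "sarr U m (Suc m) \<in> hom K (sobj U m) (sobj U (Suc m))"
    by (rule seq_arrD[OF seq]) simp
  have "Comp K (Comp K (sarr U m (Suc m)) g) f = sarr U n (Suc m)"
    using Comp_assoc[OF f g s] gf seq_compD[OF seq m, of "Suc m"] by simp
  then show ?thesis
    using that[of "Suc m"] m Comp_hom[OF g s] by simp
qed

lemma seq_injective_extend:
  assumes sub: "subcategory K L" and A: "sequence K A" and inj: "seq_injective K L A"
    and i: "i \<in> hom K (sobj A n) b"
  obtains m s where "m > n" "s \<in> hom L b (sobj A m)" "Comp L s i = sarr A n m"
proof -
  interpret L: category L using sub by (simp add: subcategory_def)
  have AL: "sequence L A" by (rule sub_sequence[OF sub A])
  have id: "sarr A n n \<in> hom L (sobj A n) (sobj A n)" by (rule seq_arrD[OF AL]) simp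
  obtain m s where m: "m \<ge> n" and s: "s \<in> hom L b (sobj A m)"
    and "Comp L s i = Comp L (sarr A n m) (sarr A n n)"
    using inj i id unfolding seq_injective_iff[OF sub A] by blast
  then have si: "Comp L s i = sarr A n m"
    using seq_compD[OF AL, of n n m] by simp
  have t: "sarr A m (Suc m) \<in> hom L (sobj A m) (sobj A (Suc m))"
    by (rule seq_arrD[OF AL]) simp
  have "Comp L (Comp L (sarr A m (Suc m)) s) i = sarr A n (Suc m)"
    using L.Comp_assoc[OF sub_hom[OF sub i] s t] si seq_compD[OF AL m, of "Suc m"] by simp
  then show ?thesis
    using that[of "Suc m"] m L.Comp_hom[OF s t] by simp
qed

text \<open>The \<open>k\<close>-th rung of the ladder: a \<open>K\<close>-arrow \<open>j : x\<^sub>k \<rightarrow> u\<^sub>p\<close> and an \<open>L\<close>-arrow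
  \<open>r : u\<^sub>p \<rightarrow> x\<^sub>q\<close> such that \<open>r \<circ> j\<close> is the bonding arrow of \<open>X\<close>. The bound \<open>k < q\<close> makes
  \<open>x\<^bsub>k+1\<^esub>\<^sup>q\<close> available for the next rung, and \<open>k \<le> p\<close> ensures that the rungs
  determine an arrow on all of \<open>U\<close>.\<close>

definition partial_retraction ::
  "('o, 'a) cat \<Rightarrow> ('o, 'a) cat \<Rightarrow> ('o, 'a) seq \<Rightarrow> ('o, 'a) seq \<Rightarrow> nat \<Rightarrow>
    nat \<times> nat \<times> 'a \<times> 'a \<Rightarrow> bool" where
  "partial_retraction K L X U k = (\<lambda>(p, q, j, r). k \<le> p \<and> k < q \<and>
     j \<in> hom K (sobj X k) (sobj U p) \<and> r \<in> hom L (sobj U p) (sobj X q) \<and>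
     Comp L r j = sarr X k q)"

lemma partial_retraction_base:
  assumes sub: "subcategory K L" and U: "fraisse_sequence K U"
    and X: "sequence K X" and inj: "seq_injective K L X"
  shows "\<exists>t. partial_retraction K L X U 0 t"
proof -
  obtain p j where j: "j \<in> hom K (sobj X 0) (sobj U p)"
    using U seq_objD[OF X, of 0] unfolding fraisse_sequence_def by blast
  obtain q r where "q > 0" "r \<in> hom L (sobj U p) (sobj X q)" "Comp L r j = sarr X 0 q"
    by (rule seq_injective_extend[OF sub X inj j])
  then have "partial_retraction K L X U 0 (p, q, j, r)"
    using j by (simp add: partial_retraction_def)
  then show ?thesis by blast
qed

lemma partial_retraction_step:
  assumes sub: "subcategory K L" and mixed: "mixed_amalgamation_property K L"
    and ext: "amalgamated_extension_property K L" and U: "fraisse_sequence K U"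
    and X: "sequence K X" and inj: "seq_injective K L X"
    and P: "partial_retraction K L X U k (p, q, j, r)"
  obtains p' q' j' r' where "partial_retraction K L X U (Suc k) (p', q', j', r')"
    "p \<le> p'" "q \<le> q'"
    "Comp L j' (sarr X k (Suc k)) = Comp L (sarr U p p') j"
    "Comp L r' (sarr U p p') = Comp L (sarr X q q') r"
proof -
  interpret K: category K using sub by (simp add: subcategory_def)
  interpret L: category L using sub by (simp add: subcategory_def)
  note lift = sub_hom[OF sub]
  have XL: "sequence L X" by (rule sub_sequence[OF sub X])
  have kp: "k \<le> p" and kq: "k < q" and j: "j \<in> hom K (sobj X k) (sobj U p)"
    and r: "r \<in> hom L (sobj U p) (sobj X q)" and rj: "Comp L r j = sarr X k q"
    using P by (auto simp: partial_retraction_def)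
  let ?s = "sarr X k (Suc k)" and ?t = "sarr X (Suc k) q"
  have s: "?s \<in> hom K (sobj X k) (sobj X (Suc k))" by (rule seq_arrD[OF X]) simp
  have t: "?t \<in> hom L (sobj X (Suc k)) (sobj X q)" by (rule seq_arrD[OF XL]) (use kq in simp)
  have "Comp L r j = Comp L ?t ?s"
    using rj seq_compD[OF XL, of k "Suc k" q] kq by simp
  then obtain y w e c l h where e: "e \<in> hom K (sobj X q) y" and c: "c \<in> hom K (sobj U p) w"
    and l: "l \<in> hom K (sobj X (Suc k)) w" and h: "h \<in> hom L w y"
    and er: "Comp L e r = Comp L h c" and et: "Comp L e ?t = Comp L h l"
    and cj: "Comp K c j = Comp K l ?s"
    using ext[unfolded amalgamated_extension_property_def, rule_format, OF j s r t] by blast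
  obtain p' g where pp: "p' > p" and g: "g \<in> hom K w (sobj U p')"
    and gc: "Comp K g c = sarr U p p'"
    by (rule fraisse_sequence_absorb[OF K.category_axioms U c])
  obtain v h' e' where h': "h' \<in> hom L (sobj U p') v" and e': "e' \<in> hom K y v"
    and h'g: "Comp L h' g = Comp L e' h"
    using mixed g h unfolding mixed_amalgamation_property_def by blast
  obtain q' z where qq: "q' > q" and z: "z \<in> hom L v (sobj X q')"
    and ze: "Comp L z (Comp K e' e) = sarr X q q'"
    by (rule seq_injective_extend[OF sub X inj K.Comp_hom[OF e e']])
  have ze': "Comp L z (Comp L e' e) = sarr X q q'"
    using ze sub_Comp[OF sub e e'] by simp
  have gc': "Comp L g c = sarr U p p'"
    using gc sub_Comp[OF sub c g] by simp
  have cj': "Comp L c j = Comp L l ?s"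
    using cj sub_Comp[OF sub j c] sub_Comp[OF sub s l] by simp
  have gl: "Comp L g l \<in> hom L (sobj X (Suc k)) (sobj U p')"
    by (rule L.Comp_hom[OF lift[OF l] lift[OF g]])
  have zh: "Comp L z h' \<in> hom L (sobj U p') (sobj X q')"
    by (rule L.Comp_hom[OF h' z])
  \<comment> \<open>With \<open>r' = z \<circ> h'\<close>, both identities required of \<open>r'\<close> are instances of the following:
    \<open>\<phi> = l\<close> gives \<open>r' \<circ> j'\<close>, and \<open>\<phi> = c\<close> gives \<open>r' \<circ> u\<^sub>p\<^bsup>p'\<^esup>\<close>.\<close>
  have key: "Comp L (Comp L z h') (Comp L g \<phi>) = Comp L (sarr X q q') \<chi>"
    if \<phi>: "\<phi> \<in> hom L d w" and \<chi>: "\<chi> \<in> hom L d (sobj X q)" and eq: "Comp L e \<chi> = Comp L h \<phi>"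
    for d \<phi> \<chi>
  proof -
    have "Comp L (Comp L z h') (Comp L g \<phi>) = Comp L z (Comp L (Comp L h' g) \<phi>)"
      using L.Comp_assoc[OF L.Comp_hom[OF \<phi> lift[OF g]] h' z]
        L.Comp_assoc[OF \<phi> lift[OF g] h'] by simp
    also have "\<dots> = Comp L z (Comp L (Comp L e' e) \<chi>)"
      using h'g L.Comp_assoc[OF \<phi> h lift[OF e']] L.Comp_assoc[OF \<chi> lift[OF e] lift[OF e']] eq
      by simp
    also have "\<dots> = Comp L (sarr X q q') \<chi>"
      using L.Comp_assoc[OF \<chi> L.Comp_hom[OF lift[OF e] lift[OF e']] z] ze' by simp
    finally show ?thesis .
  qed
  have "Comp L (Comp L z h') (Comp L g l) = sarr X (Suc k) q'"
    using key[OF lift[OF l] t et] seq_compD[OF XL, of "Suc k" q q'] kq qq by simp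
  then have "partial_retraction K L X U (Suc k) (p', q', Comp K g l, Comp L z h')"
    using kp pp kq qq K.Comp_hom[OF l g] zh sub_Comp[OF sub l g]
    by (simp add: partial_retraction_def)
  moreover have "Comp L (Comp K g l) ?s = Comp L (sarr U p p') j"
    using L.Comp_assoc[OF lift[OF s] lift[OF l] lift[OF g]]
      L.Comp_assoc[OF lift[OF j] lift[OF c] lift[OF g]] cj' gc' sub_Comp[OF sub l g] by simp
  moreover have "Comp L (Comp L z h') (sarr U p p') = Comp L (sarr X q q') r"
    using key[OF lift[OF c] r er] gc' by simp
  ultimately show ?thesis
    using that pp qq by (meson less_imp_le)
qed

text \<open>Compatibility of consecutive rungs suffices for naturality.\<close>

lemma (in category) natural_if_step:
  assumes A: "sequence C A" and B: "sequence C B" and mono: "mono \<psi>"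
    and t: "\<And>n. t n \<in> hom C (sobj A n) (sobj B (\<psi> n))"
    and step: "\<And>n. Comp C (t (Suc n)) (sarr A n (Suc n))
      = Comp C (sarr B (\<psi> n) (\<psi> (Suc n))) (t n)"
  shows "(\<psi>, t) \<in> transfs C A B"
proof -
  have "Comp C (t m) (sarr A n m) = Comp C (sarr B (\<psi> n) (\<psi> m)) (t n)" if "n \<le> m" for n m
    using that
  proof (induction m rule: dec_induct)
    case base
    show ?case
      using Comp_Ident_left[OF t] Comp_Ident_right[OF t] seq_idD[OF A] seq_idD[OF B] by simp
  next
    case (step m)
    have le: "\<psi> n \<le> \<psi> m" "\<psi> m \<le> \<psi> (Suc m)"
      using step.hyps monoD[OF mono, of n m] monoD[OF mono, of m "Suc m"] by simp_all
    have m: "sarr A m (Suc m) \<in> hom C (sobj A m) (sobj A (Suc m))"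
      by (rule seq_arrD[OF A]) simp
    have "Comp C (t (Suc m)) (sarr A n (Suc m))
        = Comp C (t (Suc m)) (Comp C (sarr A m (Suc m)) (sarr A n m))"
      using seq_compD[OF A step.hyps(1), of "Suc m"] by simp
    also have "\<dots> = Comp C (sarr B (\<psi> m) (\<psi> (Suc m))) (Comp C (t m) (sarr A n m))"
      using Comp_assoc[OF seq_arrD[OF A step.hyps(1)] m t]
        Comp_assoc[OF seq_arrD[OF A step.hyps(1)] t seq_arrD[OF B le(2)]]
        assms(5)[of m] by simp
    also have "\<dots> = Comp C (sarr B (\<psi> n) (\<psi> (Suc m))) (t n)"
      using step.IH push[OF B t le] by simp
    finally show ?case .
  qed
  then show ?thesis using mono t by (auto simp: transfs_def)
qed

lemma injective_retract_of_fraisse: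
  assumes sub: "subcategory K L" and mixed: "mixed_amalgamation_property K L"
    and ext: "amalgamated_extension_property K L" and U: "fraisse_sequence K U"
    and X: "sequence K X" and inj: "seq_injective K L X"
  shows "\<exists>J\<in>hom (sigma K) X U. \<exists>R\<in>hom (sigma_pair K L) U X.
    Comp (sigma_pair K L) R (sigma_incl L J) = Ident (sigma_pair K L) X"
proof -
  interpret K: category K using sub by (simp add: subcategory_def)
  interpret L: category L using sub by (simp add: subcategory_def)
  have UK: "sequence K U" using U by (simp add: fraisse_sequence_def)
  have XL: "sequence L X" and UL: "sequence L U"
    using sub_sequence[OF sub] X UK by auto
  let ?next = "\<lambda>k (p, q, j, r) (p', q', j', r'). p \<le> p' \<and> q \<le> q' \<and>
    Comp L j' (sarr X k (Suc k)) = Comp L (sarr U p p') j \<and>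
    Comp L r' (sarr U p p') = Comp L (sarr X q q') r"
  have "\<exists>T. \<forall>k. partial_retraction K L X U k (T k) \<and> ?next k (T k) (T (Suc k))"
  proof (rule dependent_nat_choice)
    show "\<exists>t. partial_retraction K L X U 0 t"
      by (rule partial_retraction_base[OF sub U X inj])
    fix t k
    assume "partial_retraction K L X U k t"
    moreover obtain p q j r where "t = (p, q, j, r)" by (metis surj_pair)
    ultimately show "\<exists>t'. partial_retraction K L X U (Suc k) t' \<and> ?next k t t'"
      using partial_retraction_step[OF sub mixed ext U X inj, of k p q j r] by simp metis
  qed
  then obtain T where "\<forall>k. partial_retraction K L X U k (T k) \<and> ?next k (T k) (T (Suc k))" ..
  then have T: "partial_retraction K L X U k (T k)" "?next k (T k) (T (Suc k))" for k
    by simp_all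
  define p q j r where "p k = fst (T k)" and "q k = fst (snd (T k))"
    and "j k = fst (snd (snd (T k)))" and "r k = snd (snd (snd (T k)))" for k
  have T_eq: "T k = (p k, q k, j k, r k)" for k
    by (simp add: p_def q_def j_def r_def)
  have kp: "k \<le> p k" and kq: "k < q k" and j: "j k \<in> hom K (sobj X k) (sobj U (p k))"
    and r: "r k \<in> hom L (sobj U (p k)) (sobj X (q k))" and rj: "Comp L (r k) (j k) = sarr X k (q k)"
    for k
    using T(1)[of k] by (auto simp: T_eq partial_retraction_def)
  have "p k \<le> p (Suc k)" "q k \<le> q (Suc k)" for k
    using T(2)[of k] by (auto simp: T_eq)
  then have p: "mono p" and q: "mono q" by (simp_all add: mono_iff_le_Suc)
  have j_step: "Comp L (j (Suc k)) (sarr X k (Suc k)) = Comp L (sarr U (p k) (p (Suc k))) (j k)"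
    and r_step: "Comp L (r (Suc k)) (sarr U (p k) (p (Suc k)))
      = Comp L (sarr X (q k) (q (Suc k))) (r k)" for k
    using T(2)[of k] by (auto simp: T_eq)
  have pS: "p k \<le> p (Suc k)" for k by (rule monoD[OF p]) simp

  have J: "(p, j) \<in> transfs K X U"
  proof (rule K.natural_if_step[OF X UK p j])
    fix k
    have s: "sarr X k (Suc k) \<in> hom K (sobj X k) (sobj X (Suc k))"
      by (rule seq_arrD[OF X]) simp
    show "Comp K (j (Suc k)) (sarr X k (Suc k)) = Comp K (sarr U (p k) (p (Suc k))) (j k)"
      using j_step[of k] sub_Comp[OF sub s j] sub_Comp[OF sub j seq_arrD[OF UK pS]] by simp
  qed

  \<comment> \<open>The arrows \<open>r k\<close> are natural on the subsequence of \<open>U\<close> selected by \<open>p\<close>.\<close>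
  let ?U = "\<lparr>sobj = \<lambda>n. sobj U (p n), sarr = \<lambda>n m. sarr U (p n) (p m)\<rparr>"
  have "sequence L ?U"
    using UL monoD[OF p] unfolding sequence_def by simp
  then have "(q, r) \<in> transfs L ?U X"
    by (rule L.natural_if_step[OF _ XL q]) (use r r_step in simp_all)
  then have ladder: "Comp L (r m) (sarr U (p n) (p m)) = Comp L (sarr X (q n) (q m)) (r n)"
    if "n \<le> m" for n m
    using transfsD(3)[OF _ that] by fastforce

  \<comment> \<open>On \<open>u\<^sub>n\<close>, the retraction moves to the stage \<open>p n \<ge> n\<close>, where \<open>r n\<close> is defined.\<close>
  define \<rho> where "\<rho> n = Comp L (r n) (sarr U n (p n))" for n
  have \<rho>: "\<rho> n \<in> hom L (sobj U n) (sobj X (q n))" for n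
    unfolding \<rho>_def by (rule L.Comp_hom[OF seq_arrD[OF UL kp] r])
  have "Comp L (\<rho> m) (sarr U n m) = Comp L (sarr X (q n) (q m)) (\<rho> n)" if nm: "n \<le> m" for n m
  proof -
    have le: "p n \<le> p m" "q n \<le> q m" by (rule monoD[OF p nm], rule monoD[OF q nm])
    have "Comp L (\<rho> m) (sarr U n m) = Comp L (r m) (sarr U n (p m))"
      using L.Comp_assoc[OF seq_arrD[OF UL nm] seq_arrD[OF UL kp] r] seq_compD[OF UL nm kp]
      by (simp add: \<rho>_def)
    also have "\<dots> = Comp L (Comp L (r m) (sarr U (p n) (p m))) (sarr U n (p n))"
      using L.Comp_assoc[OF seq_arrD[OF UL kp] seq_arrD[OF UL le(1)] r] seq_compD[OF UL kp le(1)]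
      by simp
    also have "\<dots> = Comp L (sarr X (q n) (q m)) (\<rho> n)"
      using L.Comp_assoc[OF seq_arrD[OF UL kp] r seq_arrD[OF XL le(2)]] ladder[OF nm]
      by (simp add: \<rho>_def)
    finally show ?thesis .
  qed
  then have R: "(q, \<rho>) \<in> transfs L U X"
    using q \<rho> by (simp add: transfs_def)

  have JL: "(p, j) \<in> transfs L X U" by (rule sub_transfs[OF sub X UK J])
  have id: "(id, \<lambda>n. Ident L (sobj X n)) \<in> transfs L X X" by (rule L.ident_transf[OF XL])
  have RJ: "Comp L (\<rho> (p n)) (j n) = sarr X n (q (p n))" and nq: "n \<le> q (p n)" for n
  proof -
    have jn: "j n \<in> hom L (sobj X n) (sobj U (p n))" by (rule sub_hom[OF sub j])
    have le: "n \<le> q n" "q n \<le> q (p n)" using kq[of n] monoD[OF q kp[of n]] by auto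
    then show "n \<le> q (p n)" by simp
    have "Comp L (\<rho> (p n)) (j n) = Comp L (Comp L (sarr X (q n) (q (p n))) (r n)) (j n)"
      unfolding \<rho>_def using ladder[OF kp] by simp
    also have "\<dots> = sarr X n (q (p n))"
      using L.Comp_assoc[OF jn r seq_arrD[OF XL le(2)]] rj seq_compD[OF XL le] by simp
    finally show "Comp L (\<rho> (p n)) (j n) = sarr X n (q (p n))" .
  qed
  have RJ_transf: "transf_comp L (q, \<rho>) (p, j) \<in> transfs L X X"
    by (rule L.transf_comp_in[OF XL UL XL JL R])
  have "Comp L (sarr X (q (p n)) (q (p n))) (Comp L (\<rho> (p n)) (j n))
      = Comp L (sarr X n (q (p n))) (Ident L (sobj X n))" for n
    using L.Comp_Ident_left[OF seq_arrD[OF XL nq]] L.Comp_Ident_right[OF seq_arrD[OF XL nq]]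
      seq_idD[OF XL] RJ by simp
  then have "\<exists>m\<ge>max (q (p n)) n. Comp L (sarr X (q (p n)) m) (Comp L (\<rho> (p n)) (j n))
      = Comp L (sarr X n m) (Ident L (sobj X n))" for n
    using nq[of n] by (intro exI[of _ "q (p n)"]) simp
  then have "(transf_comp L (q, \<rho>) (p, j), (id, \<lambda>n. Ident L (sobj X n))) \<in> transf_equiv L X X"
    using id RJ_transf by (simp add: transf_equiv_def transf_comp_def)
  then have "Comp (sigma L) (arr_class L U X (q, \<rho>)) (arr_class L X U (p, j))
      = arr_class L X X (id, \<lambda>n. Ident L (sobj X n))"
    using L.sigma_Comp[OF XL UL XL JL R] L.arr_class_eq_iff[OF XL RJ_transf id] by simp
  also have "\<dots> = Ident (sigma_pair K L) X"
    by (simp add: sigma_pair_def full_subcat_def sigma_def)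
  finally have "Comp (sigma_pair K L) (arr_class L U X (q, \<rho>)) (sigma_incl L (arr_class K X U (p, j)))
      = Ident (sigma_pair K L) X"
    by (simp add: sigma_pair_Comp sigma_incl_arr_class[OF sub X UK J])
  moreover have "arr_class K X U (p, j) \<in> hom (sigma K) X U"
    using J by (simp add: K.hom_sigma[OF X UK])
  moreover have "arr_class L U X (q, \<rho>) \<in> hom (sigma_pair K L) U X"
    using R by (simp add: hom_sigma_pair[OF sub UK X] L.hom_sigma[OF UL XL])
  ultimately show ?thesis by blast
qed

theorem theorem2p7:
  fixes K L :: "('o, 'a) cat" and U X :: "('o, 'a) seq"
  assumes "property_H K L"
    and "fraisse_sequence K U"
    and "sequence K X"
  shows "(seq_injective K L X \<longleftrightarrow>
           (\<exists>J\<in>hom (sigma K) X U. \<exists>R\<in>hom (sigma_pair K L) U X.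
              Comp (sigma_pair K L) R (sigma_incl L J) = Ident (sigma_pair K L) X)) \<and>
         (seq_injective K L X \<longleftrightarrow> retract (sigma_pair K L) X U)"
    (is "(?a \<longleftrightarrow> ?b) \<and> (?a \<longleftrightarrow> ?c)")
proof -
  have sub: "subcategory K L" and mixed: "mixed_amalgamation_property K L"
    and ext: "amalgamated_extension_property K L"
    using assms(1) by (auto simp: property_H_def)
  have "?b" if "?a"
    by (rule injective_retract_of_fraisse[OF sub mixed ext assms(2,3) that])
  moreover have "?c" if "?b"
    using that sigma_incl_hom[OF sub] unfolding retract_def by blast
  moreover have "?a" if "?c"
    by (rule seq_injective_retract[OF sub fraisse_sequence_injective[OF sub mixed assms(2)] that])
  ultimately show ?thesis by blast
qed

end
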